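(* Let $G$ be a non-discrete locally compact unimodular group with Haar measure $\nu$. For every neighborhood $U$ of the identity and every compact set $B\subseteq G$ there exists a compact set $C\supseteq B$ that admits a $U$-fine equisize partition.
   Context: A finite partition $\mathcal P$ of a set $C\subseteq G$ into Haar-measurable sets is $U$-fine if for every $P\in\mathcal P$ there is $g\in G$ with $P\subseteq gU$, and equisize if all sets in $\mathcal P$ have the same Haar measure. *)

theory Defs
  imports "HOL-Analysis.Analysis"
begin

text \<open>We model the group G as a type 'a of class topological_group_add
  (a not necessarily commutative group written additively, with continuous
  operations) which is Hausdorff. The identity is 0, and the left translate gU
  is written (\<lambda>u. g + u) ` U.\<close>

definition locally_compact_type :: "'a::topological_space itself \<Rightarrow> bool" where
  "locally_compact_type _ \<longleftrightarrow>
     (\<forall>x::'a. \<exists>V K. open V \<and> compact K \<and> x \<in> V \<and> V \<subseteq> K)"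

definition discrete_type :: "'a::topological_space itself \<Rightarrow> bool" where
  "discrete_type _ \<longleftrightarrow> (\<forall>x::'a. open {x})"

definition radon_measure :: "'a::topological_space measure \<Rightarrow> bool" where
  "radon_measure M \<longleftrightarrow>
     sets M = sets borel \<and>
     (\<forall>K. compact K \<longrightarrow> emeasure M K < \<infinity>) \<and>
     (\<forall>A \<in> sets borel. emeasure M A = (INF V \<in> {V. open V \<and> A \<subseteq> V}. emeasure M V)) \<and>
     (\<forall>V. open V \<longrightarrow> emeasure M V = (SUP K \<in> {K. compact K \<and> K \<subseteq> V}. emeasure M K))"

definition haar_measure :: "'a::topological_group_add measure \<Rightarrow> bool" where
  "haar_measure M \<longleftrightarrow>
     radon_measure M \<and> emeasure M UNIV \<noteq> 0 \<and>
     (\<forall>g. \<forall>A \<in> sets borel. emeasure M ((\<lambda>x. g + x) ` A) = emeasure M A)"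

definition unimodular_haar :: "'a::topological_group_add measure \<Rightarrow> bool" where
  "unimodular_haar M \<longleftrightarrow> haar_measure M \<and>
     (\<forall>g. \<forall>A \<in> sets borel. emeasure M ((\<lambda>x. x + g) ` A) = emeasure M A)"

definition neighborhood_of :: "'a::topological_space set \<Rightarrow> 'a \<Rightarrow> bool" where
  "neighborhood_of U x \<longleftrightarrow> (\<exists>V. open V \<and> x \<in> V \<and> V \<subseteq> U)"

definition measurable_partition :: "'a measure \<Rightarrow> 'a set set \<Rightarrow> 'a set \<Rightarrow> bool" where
  "measurable_partition M P C \<longleftrightarrow>
     finite P \<and> P \<subseteq> sets M \<and> {} \<notin> P \<and> \<Union>P = C \<and>
     (\<forall>A\<in>P. \<forall>B\<in>P. A \<noteq> B \<longrightarrow> A \<inter> B = {})"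

definition U_fine :: "'a::group_add set \<Rightarrow> 'a set set \<Rightarrow> bool" where
  "U_fine U P \<longleftrightarrow> (\<forall>A\<in>P. \<exists>g. A \<subseteq> (\<lambda>u. g + u) ` U)"

definition equisize :: "'a measure \<Rightarrow> 'a set set \<Rightarrow> bool" where
  "equisize M P \<longleftrightarrow> (\<forall>A\<in>P. \<forall>B\<in>P. emeasure M A = emeasure M B)"

end

theory Submission
  imports Defs
begin

text \<open>
  Choose a small open symmetric \<open>V\<close> and let \<open>H\<close> be the open subgroup it generates. A finite
  set of points of \<open>B\<close>, translated into \<open>H\<close>, is within \<open>V\<close> of a finite
  \<open>V\<close>-separated set \<open>F \<subseteq> H\<close> that is connected through steps in \<open>V + V\<close>. The compact set
  \<open>F + K\<close>, \<open>K = closure (V + V)\<close>, splits into one piece per \<open>f \<in> F\<close>, and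
  separation lets every piece contain a translate \<open>f + W\<close> of a fixed open set, so all pieces have
  measure at least \<open>\<nu> W\<close>. Since \<open>\<nu>\<close> has no atoms, for \<open>\<epsilon> = \<nu> (F + K) / N \<le> \<nu> W\<close> the pieces
  can be cut into sets of measure \<open>\<epsilon>\<close>, the remainders being pushed along the edges of a
  spanning tree of \<open>F\<close>. Finally this partition is copied by left translation into each of the finitely
  many cosets of \<open>H\<close> that meet \<open>B\<close>; the copies have the same \<open>\<epsilon>\<close>.
\<close>

section \<open>Equipartitions along trees\<close>

text \<open>Absence of atoms, stated through finite covers by sets of small measure. The covering
  sets need not lie in \<open>A\<close>, so the property passes to subsets at once.\<close>

definition finely_divisible :: "'a measure \<Rightarrow> 'a set \<Rightarrow> bool" where
  "finely_divisible M A \<longleftrightarrow>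
     (\<forall>\<delta>>0. \<exists>\<D>. finite \<D> \<and> \<D> \<subseteq> fmeasurable M \<and> A \<subseteq> \<Union>\<D> \<and> (\<forall>D\<in>\<D>. measure M D < \<delta>))"

lemma finely_divisible_subset:
  "finely_divisible M A \<Longrightarrow> B \<subseteq> A \<Longrightarrow> finely_divisible M B"
  unfolding finely_divisible_def by (meson order_trans)

text \<open>Remove the covering sets from \<open>A\<close> one after another. Each removal costs
  less than \<open>\<delta>\<close>, so the first remainder of measure below \<open>r\<close> misses
  \<open>r\<close> by at most \<open>\<delta>\<close>.\<close>

lemma exists_subset_measure_approx:
  assumes "finite \<D>" "\<D> \<subseteq> fmeasurable M" "A \<subseteq> \<Union>\<D>" "\<forall>D\<in>\<D>. measure M D < \<delta>"
    and "\<delta> > 0" "A \<in> fmeasurable M" "0 \<le> r" "r \<le> measure M A"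
  shows "\<exists>S\<in>sets M. S \<subseteq> A \<and> r - \<delta> \<le> measure M S \<and> measure M S \<le> r"
  using assms
proof (induction \<D> arbitrary: A rule: finite_induct)
  case empty
  then show ?case by (intro bexI[of _ "{}"]) auto
next
  case (insert D \<D>)
  have D: "D \<in> fmeasurable M" "measure M D < \<delta>"
    using insert.prems by auto
  have AD: "A - D \<in> fmeasurable M"
    using insert.prems D by auto
  show ?case
  proof (cases "r \<le> measure M (A - D)")
    case True
    have "\<exists>S\<in>sets M. S \<subseteq> A - D \<and> r - \<delta> \<le> measure M S \<and> measure M S \<le> r"
      using insert.prems True AD by (intro insert.IH) auto
    then show ?thesis by blast
  next
    case False
    have "measure M A \<le> measure M ((A - D) \<union> D)"
      using insert.prems D by (intro measure_mono_fmeasurable) auto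
    also have "\<dots> \<le> measure M (A - D) + measure M D"
      using AD D by (intro measure_Un_le) auto
    finally have "r - \<delta> \<le> measure M (A - D)"
      using D insert.prems by linarith
    then show ?thesis
      using False AD by (intro bexI[of _ "A - D"]) auto
  qed
qed

text \<open>Approximations of \<open>r\<close> from below are enlarged step by step to an increasing
  sequence. Its union has measure exactly \<open>r\<close> by continuity from below.\<close>

lemma exists_subset_measure_eq:
  assumes fd: "finely_divisible M A" and A: "A \<in> fmeasurable M"
    and r: "0 \<le> r" "r \<le> measure M A"
  shows "\<exists>R\<in>sets M. R \<subseteq> A \<and> measure M R = r"
proof -
  have approx: "\<exists>S\<in>sets M. S \<subseteq> B \<and> s - \<delta> \<le> measure M S \<and> measure M S \<le> s"
    if B: "B \<subseteq> A" "B \<in> sets M" and s: "0 \<le> s" "s \<le> measure M B" and "\<delta> > 0" for B s \<delta>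
  proof -
    have "finely_divisible M B"
      using finely_divisible_subset[OF fd B(1)] .
    then obtain \<D> where "finite \<D>" "\<D> \<subseteq> fmeasurable M" "B \<subseteq> \<Union>\<D>" "\<forall>D\<in>\<D>. measure M D < \<delta>"
      using \<open>\<delta> > 0\<close> unfolding finely_divisible_def by (elim allE[of _ \<delta>] impE exE conjE)
    then show ?thesis
      using \<open>\<delta> > 0\<close> fmeasurableI2[OF A B] s by (rule exists_subset_measure_approx)
  qed
  let ?P = "\<lambda>n R. R \<in> sets M \<and> R \<subseteq> A \<and> r - inverse (real (Suc n)) \<le> measure M R \<and> measure M R \<le> r"
  have "\<exists>R. \<forall>n. ?P n (R n) \<and> R n \<subseteq> R (Suc n)"
  proof (rule dependent_nat_choice)
    show "\<exists>R. ?P 0 R"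
      using approx[OF subset_refl fmeasurableD[OF A] r, of "inverse (real (Suc 0))"] by auto
  next
    fix R n assume R: "?P n R"
    then have Rf: "R \<in> fmeasurable M" using A fmeasurableI2 by blast
    have d: "measure M (A - R) = measure M A - measure M R"
      using R A by (intro measure_Diff) (auto simp: fmeasurableD2)
    \<comment> \<open>\<open>S\<close> fills most of the deficit \<open>r - measure M R\<close>.
      Taking it from \<open>A - R\<close> keeps the sequence increasing and the measure at most
      \<open>r\<close>.\<close>
    obtain S where S: "S \<in> sets M" "S \<subseteq> A - R"
        "r - measure M R - inverse (real (Suc (Suc n))) \<le> measure M S" "measure M S \<le> r - measure M R"
    proof -
      have "A - R \<in> sets M" "0 \<le> r - measure M R" "r - measure M R \<le> measure M (A - R)"
        using R A r unfolding d by auto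
      from approx[OF Diff_subset this, of "inverse (real (Suc (Suc n)))"] show ?thesis
        using that by auto
    qed
    have Sf: "S \<in> fmeasurable M"
      using S A fmeasurableI2[of A M S] by blast
    have "measure M (R \<union> S) = measure M R + measure M S"
      using S R Rf Sf by (intro measure_Union) (auto simp: fmeasurableD2)
    then have "?P (Suc n) (R \<union> S)"
      using S R by (intro conjI sets.Un) (linarith | blast)+
    then show "\<exists>S. ?P (Suc n) S \<and> R \<subseteq> S" by blast
  qed
  then obtain R where "\<forall>n. ?P n (R n) \<and> R n \<subseteq> R (Suc n)" by blast
  then have R: "\<And>n. ?P n (R n)" and mono: "\<And>n. R n \<subseteq> R (Suc n)" by blast+
  have U: "(\<Union>n. R n) \<in> sets M" "(\<Union>n. R n) \<subseteq> A"
    using R by (blast intro: sets.countable_nat_UN)+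
  have "(\<lambda>n. measure M (R n)) \<longlonglongrightarrow> measure M (\<Union>n. R n)"
  proof (rule Lim_measure_incseq)
    show "range R \<subseteq> sets M" using R by blast
    show "incseq R" using mono by (rule incseq_SucI)
    show "emeasure M (\<Union>n. R n) \<noteq> \<infinity>"
      using fmeasurableD2[OF fmeasurableI2[OF A U(2) U(1)]] by simp
  qed
  moreover have "(\<lambda>n. measure M (R n)) \<longlonglongrightarrow> r"
  proof (rule tendsto_sandwich)
    show "(\<lambda>n. r - inverse (real (Suc n))) \<longlonglongrightarrow> r"
      using tendsto_diff[OF tendsto_const LIMSEQ_inverse_real_of_nat, of r] by simp
    show "(\<lambda>n. r) \<longlonglongrightarrow> r" by simp
    show "\<forall>\<^sub>F n in sequentially. r - inverse (real (Suc n)) \<le> measure M (R n)"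
      "\<forall>\<^sub>F n in sequentially. measure M (R n) \<le> r"
      by (intro always_eventually allI; use R in blast)+
  qed
  ultimately have "measure M (\<Union>n. R n) = r"
    by (rule LIMSEQ_unique)
  then show ?thesis using U by blast
qed


text \<open>Sets of measure \<open>\<epsilon>\<close> are cut off one at a time. The induction ends
  at \<open>n = 1\<close>, where the rest itself is the last piece; for \<open>n = 0\<close> a
  nonempty null set would have no such partition.\<close>

lemma exists_equal_partition:
  assumes "finely_divisible M A" "A \<in> fmeasurable M" "\<epsilon> > 0" "measure M A = real n * \<epsilon>" "n > 0"
  shows "\<exists>P. finite P \<and> disjoint P \<and> P \<subseteq> fmeasurable M \<and> \<Union>P = A \<and> (\<forall>X\<in>P. measure M X = \<epsilon>)"
  using assms(5,1-4)
proof (induction n arbitrary: A rule: nat_induct_non_zero)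
  case 1
  then show ?case by (intro exI[of _ "{A}"]) auto
next
  case (Suc n)
  have "\<epsilon> \<le> measure M A"
    using Suc.prems by (simp add: algebra_simps)
  then obtain R where R: "R \<in> sets M" "R \<subseteq> A" "measure M R = \<epsilon>"
    using exists_subset_measure_eq[OF Suc.prems(1,2), of \<epsilon>] Suc.prems by auto
  have Rf: "R \<in> fmeasurable M" using R Suc.prems fmeasurableI2 by blast
  have "measure M (A - R) = real n * \<epsilon>"
    using R Suc.prems by (subst measure_Diff) (auto simp: fmeasurableD2 algebra_simps)
  then have "\<exists>P. finite P \<and> disjoint P \<and> P \<subseteq> fmeasurable M \<and> \<Union>P = A - R \<and> (\<forall>X\<in>P. measure M X = \<epsilon>)"
    using Suc.prems Rf by (intro Suc.IH) (auto intro: finely_divisible_subset)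
  then obtain P where P: "finite P" "disjoint P" "P \<subseteq> fmeasurable M" "\<Union>P = A - R"
    "\<forall>X\<in>P. measure M X = \<epsilon>"
    by (elim exE conjE)
  have "disjoint ({R} \<union> P)"
    using P by (intro disjoint_union) auto
  then show ?case
    using P R Rf by (intro exI[of _ "insert R P"]) auto
qed

section \<open>Redistribution of mass along a finite tree\<close>

text \<open>A tree is given by an order of attaching its vertices, so rule induction removes leaves.
  In \<open>rel f g\<close> the first argument is the parent and the second the new leaf.\<close>

inductive tree_on :: "('i \<Rightarrow> 'i \<Rightarrow> bool) \<Rightarrow> 'i set \<Rightarrow> bool" for rel where
  root: "tree_on rel {r}"
| leaf: "tree_on rel F \<Longrightarrow> f \<in> F \<Longrightarrow> g \<notin> F \<Longrightarrow> rel f g \<Longrightarrow> tree_on rel (insert g F)"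

lemma tree_on_finite: "tree_on rel F \<Longrightarrow> finite F"
  by (induction rule: tree_on.induct) auto

text \<open>Leaves are removed one at a time: the leaf is cut into pieces of size \<open>\<epsilon>\<close>, and the remainder,
  smaller than \<open>\<epsilon>\<close>, is passed on to its parent. Taking the remainder from the core
  \<open>A g\<close>, rather than from what \<open>g\<close> itself received, keeps mass from travelling more than one edge.\<close>

lemma tree_equipartition:
  assumes "tree_on rel F" and eps: "\<epsilon> > 0"
    and "\<And>f g. f \<in> F \<Longrightarrow> g \<in> F \<Longrightarrow> rel f g \<Longrightarrow> A g \<subseteq> S f"
    and "\<And>f. f \<in> F \<Longrightarrow> A f \<in> sets M" "\<And>f. f \<in> F \<Longrightarrow> \<epsilon> \<le> measure M (A f)"
      "\<And>f. f \<in> F \<Longrightarrow> A f \<subseteq> T f" "\<And>f. f \<in> F \<Longrightarrow> T f \<subseteq> S f"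
      "\<And>f. f \<in> F \<Longrightarrow> T f \<in> fmeasurable M"
    and fd: "finely_divisible M Z" and "\<Union>(T ` F) \<subseteq> Z"
    and "disjoint_family_on T F" "measure M (\<Union>(T ` F)) = real N * \<epsilon>"
  shows "\<exists>P. finite P \<and> disjoint P \<and> P \<subseteq> fmeasurable M \<and> \<Union>P = \<Union>(T ` F) \<and>
           (\<forall>X\<in>P. measure M X = \<epsilon> \<and> (\<exists>f\<in>F. X \<subseteq> S f))"
  using assms(1) assms(4-8,10-12,3)
\<comment> \<open>\<open>T f\<close> is the current load of \<open>f\<close>: its core
  \<open>A f\<close> and the remainders received from removed leaves. Loads and the number
  \<open>N\<close> of pieces vary in the induction; the cores and the bounds \<open>S f\<close> do
  not.\<close>
proof (induction F arbitrary: T N rule: tree_on.induct)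
  case (root r)
  have "\<epsilon> \<le> measure M (T r)"
    using root.prems measure_mono_fmeasurable[of "A r" "T r" M] by fastforce
  then have "N > 0"
    using root.prems eps by (cases N) auto
  then obtain P where "finite P" "disjoint P" "P \<subseteq> fmeasurable M" "\<Union>P = T r" "\<forall>X\<in>P. measure M X = \<epsilon>"
    using exists_equal_partition[of M "T r" \<epsilon> N] root.prems eps fd finely_divisible_subset[of M Z "T r"]
    by auto
  then show ?case
    using root.prems by (intro exI[of _ P]) auto
next
  case (leaf F f g)
  note p = leaf.prems
  have fin: "finite F" using leaf.hyps tree_on_finite by blast
  define t where "t = measure M (T g)"
  \<comment> \<open>The number of full pieces in the load of the leaf. The rest
    \<open>t - real n * \<epsilon>\<close> is less than \<open>\<epsilon>\<close>, hence fits into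
    the core \<open>A g\<close>.\<close>
  define n where "n = nat \<lfloor>t / \<epsilon>\<rfloor>"
  have tA: "measure M (A g) \<le> t"
    unfolding t_def using p by (intro measure_mono_fmeasurable) auto
  have te: "\<epsilon> \<le> t" using tA p(2)[of g] by auto
  have "1 \<le> t / \<epsilon>" using te eps by simp
  then have n0: "n > 0" and nr: "real n = of_int \<lfloor>t / \<epsilon>\<rfloor>"
    unfolding n_def by (auto simp: le_floor_iff)
  have "real n \<le> t / \<epsilon>" "t / \<epsilon> < real n + 1" unfolding nr by linarith+
  then have n: "real n * \<epsilon> \<le> t" "t < real n * \<epsilon> + \<epsilon>"
    using eps by (auto simp: field_simps)
  have Ag: "A g \<in> fmeasurable M"
    using fmeasurableI2[OF p(5) p(3) p(1), OF insertI1 insertI1 insertI1] .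
  have "finely_divisible M (A g)"
    using p(3)[OF insertI1] p(6) by (intro finely_divisible_subset[OF fd]) auto
  then obtain R where R: "R \<in> sets M" "R \<subseteq> A g" "measure M R = t - real n * \<epsilon>"
    using exists_subset_measure_eq[of M "A g" "t - real n * \<epsilon>"] Ag n p(2)[OF insertI1] by auto
  have Rf: "R \<in> fmeasurable M" using fmeasurableI2[OF Ag R(2,1)] .
  have RT: "R \<subseteq> T g" using R(2) p(3)[OF insertI1] by (rule order_trans)
  have Tgf: "T g \<in> fmeasurable M" using p(5) by simp
  have mTR: "measure M (T g - R) = real n * \<epsilon>"
    using R RT Tgf by (subst measure_Diff) (auto simp: fmeasurableD2 t_def)
  have fdTR: "finely_divisible M (T g - R)"
    using p(6) by (intro finely_divisible_subset[OF fd]) auto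
  have TRf: "T g - R \<in> fmeasurable M" using Tgf Rf by auto
  obtain P1 where P1: "finite P1" "disjoint P1" "P1 \<subseteq> fmeasurable M" "\<Union>P1 = T g - R"
      "\<forall>X\<in>P1. measure M X = \<epsilon>"
    using exists_equal_partition[OF fdTR TRf eps mTR n0] by (elim exE conjE)
  define T' where "T' = T(f := T f \<union> R)"
  have disjg: "T h \<inter> T g = {}" if "h \<in> F" for h
    using p(7) that leaf.hyps by (auto simp: disjoint_family_on_def)
  have UT': "\<Union>(T' ` F) = \<Union>(T ` insert g F) - (T g - R)"
  proof -
    have "\<Union>(T' ` F) = \<Union>(T ` F) \<union> R"
      using leaf.hyps(2) by (auto simp: T'_def split: if_splits)
    moreover have "\<Union>(T ` F) \<inter> T g = {}" using disjg by blast
    ultimately show ?thesis using RT by auto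
  qed
  have Uf: "\<Union>(T ` insert g F) \<in> fmeasurable M"
    using p fin by (intro fmeasurable.finite_UN) auto
  have mN: "measure M (\<Union>(T' ` F)) = real N * \<epsilon> - real n * \<epsilon>"
    unfolding UT' using Uf Tgf Rf p(8) mTR
    by (subst measure_Diff) (auto simp: fmeasurableD2 simp del: image_insert Union_insert)
  \<comment> \<open>What is left has nonnegative measure, so \<open>n \<le> N\<close> and the
    truncated subtraction \<open>N - n\<close> is a true difference.\<close>
  then have "real n * \<epsilon> \<le> real N * \<epsilon>"
    by (metis diff_ge_0_iff_ge measure_nonneg)
  then have "n \<le> N" using eps by simp
  then have mN': "measure M (\<Union>(T' ` F)) = real (N - n) * \<epsilon>"
    using mN by (simp add: of_nat_diff algebra_simps)
  have "disjoint_family_on T' F"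
  proof (unfold disjoint_family_on_def, intro ballI impI)
    fix m n assume mn: "m \<in> F" "n \<in> F" "m \<noteq> n"
    then have "T m \<inter> T n = {}"
      using disjoint_family_onD[OF p(7)] by blast
    moreover have "R \<inter> T m = {}" "R \<inter> T n = {}"
      using mn disjg RT by blast+
    ultimately show "T' m \<inter> T' n = {}"
      using mn unfolding T'_def by auto
  qed
  moreover have "R \<subseteq> S f" using R(2) p(9)[OF insertI2[OF leaf.hyps(2)] insertI1 leaf.hyps(4)] by (rule order_trans)
  moreover have "A h \<subseteq> T' h" if "h \<in> F" for h
    using p(3)[OF insertI2[OF that]] by (auto simp: T'_def)
  moreover have "T' h \<in> fmeasurable M" if "h \<in> F" for h
    using p(5)[OF insertI2[OF that]] Rf by (auto simp: T'_def)
  moreover have "T' h \<subseteq> S h" if "h \<in> F" for h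
    using p(4)[OF insertI2[OF that]] \<open>R \<subseteq> S f\<close> by (auto simp: T'_def)
  moreover have "\<Union>(T' ` F) \<subseteq> Z"
    using UT' p(6) by blast
  ultimately have "\<exists>P. finite P \<and> disjoint P \<and> P \<subseteq> fmeasurable M \<and> \<Union>P = \<Union>(T' ` F) \<and>
           (\<forall>X\<in>P. measure M X = \<epsilon> \<and> (\<exists>f\<in>F. X \<subseteq> S f))"
    by (intro leaf.IH[OF p(1) p(2) _ _ _ _ _ mN' p(9)]) simp_all
  then obtain P2 where P2: "finite P2" "disjoint P2" "P2 \<subseteq> fmeasurable M" "\<Union>P2 = \<Union>(T' ` F)"
      "\<forall>X\<in>P2. measure M X = \<epsilon> \<and> (\<exists>f\<in>F. X \<subseteq> S f)"
    by (elim exE conjE)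
  have "disjoint (P1 \<union> P2)"
    using P1 P2 UT' by (intro disjoint_union) auto
  moreover have "\<Union>(P1 \<union> P2) = \<Union>(T ` insert g F)"
    using P1 P2 UT' by auto
  moreover have "\<exists>f\<in>insert g F. X \<subseteq> S f" if "X \<in> P1 \<union> P2" for X
    using that P1(4) p(4)[OF insertI1] P2(5) by blast
  moreover have "measure M X = \<epsilon>" if "X \<in> P1 \<union> P2" for X
    using that P1(5) P2(5) by blast
  ultimately show ?case
    using P1(1,3) P2(1,3) by (intro exI[of _ "P1 \<union> P2"] conjI ballI) simp_all
qed

text \<open>The new index \<open>g\<close> receives its core \<open>W g\<close> and the part of
  \<open>K g\<close> not yet covered, while the older sets give up \<open>W g\<close>. Older cores
  survive because the cores are disjoint, and the union loses nothing because \<open>W g\<close>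
  goes to \<open>g\<close>.\<close>

lemma disjointify_keeping_cores:
  assumes "finite F" "disjoint_family_on W F"
    and "\<And>f. f \<in> F \<Longrightarrow> W f \<subseteq> K f" "\<And>f. f \<in> F \<Longrightarrow> W f \<in> sets M" "\<And>f. f \<in> F \<Longrightarrow> K f \<in> sets M"
  shows "\<exists>A. disjoint_family_on A F \<and> \<Union>(A ` F) = \<Union>(K ` F) \<and>
           (\<forall>f\<in>F. W f \<subseteq> A f \<and> A f \<subseteq> K f \<and> A f \<in> sets M)"
  using assms
proof (induction F rule: finite_induct)
  case empty
  then show ?case by (auto simp: disjoint_family_on_def)
next
  case (insert g F)
  have "\<exists>A. disjoint_family_on A F \<and> \<Union>(A ` F) = \<Union>(K ` F) \<and>
           (\<forall>f\<in>F. W f \<subseteq> A f \<and> A f \<subseteq> K f \<and> A f \<in> sets M)"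
    using insert.prems by (intro insert.IH) (auto simp: disjoint_family_on_def)
  then obtain A where A: "disjoint_family_on A F" "\<Union>(A ` F) = \<Union>(K ` F)"
    "\<forall>f\<in>F. W f \<subseteq> A f \<and> A f \<subseteq> K f \<and> A f \<in> sets M"
    by (elim exE conjE)
  define A' where "A' f = (if f = g then W g \<union> (K g - \<Union>(K ` F)) else A f - W g)" for f
  have Ws: "W g \<inter> W f = {}" if "f \<in> F" for f
    using that insert.hyps by (intro disjoint_family_onD[OF insert.prems(1)]) auto
  have "disjoint_family_on A' (insert g F)"
  proof (unfold disjoint_family_on_def, intro ballI impI)
    fix m n assume mn: "m \<in> insert g F" "n \<in> insert g F" "m \<noteq> n"
    have core: "A' g \<inter> A' f = {}" if "f \<in> F" for f
      using bspec[OF A(3) that] that insert.hyps by (auto simp: A'_def)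
    show "A' m \<inter> A' n = {}"
    proof (cases "m = g \<or> n = g")
      case True
      then show ?thesis using core mn by blast
    next
      case False
      then have "A m \<inter> A n = {}" using disjoint_family_onD[OF A(1)] mn by blast
      then show ?thesis using False by (auto simp: A'_def)
    qed
  qed
  moreover have "\<Union>(A' ` insert g F) = \<Union>(K ` insert g F)"
  proof -
    have "\<Union>(A' ` F) = \<Union>(K ` F) - W g"
      unfolding A(2)[symmetric] A'_def using insert.hyps by auto
    moreover have "A' g = W g \<union> (K g - \<Union>(K ` F))" by (simp add: A'_def)
    moreover have "W g \<subseteq> K g" using insert.prems by blast
    ultimately show ?thesis by auto
  qed
  moreover have "\<Union>(K ` F) \<in> sets M"
    using insert by (intro sets.finite_UN) auto
  moreover have "W f \<subseteq> A' f \<and> A' f \<subseteq> K f \<and> A' f \<in> sets M" if f: "f \<in> insert g F" for f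
  proof (cases "f = g")
    case True
    then show ?thesis
      using insert.prems(2-4)[OF insertI1] \<open>\<Union>(K ` F) \<in> sets M\<close> by (auto simp: A'_def)
  next
    case False
    then have "f \<in> F" using f by auto
    have "W g \<in> sets M" using insert.prems by blast
    then show ?thesis
      using False bspec[OF A(3) \<open>f \<in> F\<close>] Ws[OF \<open>f \<in> F\<close>] by (auto simp: A'_def)
  qed
  ultimately show ?case by (intro exI[of _ A'] conjI ballI) auto
qed

section \<open>Haar measure\<close>

text \<open>In preimage form, openness and Borel measurability of left translates follow from
  continuity of translation by \<open>- g\<close>.\<close>

lemma left_translate_eq_vimage:
  fixes g :: "'a::group_add"
  shows "(\<lambda>x. g + x) ` A = (\<lambda>x. - g + x) -` A"
proof -
  have "y \<in> (\<lambda>x. g + x) ` A" if "- g + y \<in> A" for y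
    using imageI[OF that, of "\<lambda>x. g + x"] by (simp add: add.assoc[symmetric])
  then show ?thesis by (auto simp: add.assoc[symmetric])
qed

lemma open_left_translate:
  fixes g :: "'a::topological_group_add"
  assumes "open A"
  shows "open ((\<lambda>x. g + x) ` A)"
  unfolding left_translate_eq_vimage
  by (intro open_vimage assms continuous_intros)

lemma compact_left_translate:
  fixes g :: "'a::topological_group_add"
  assumes "compact A"
  shows "compact ((\<lambda>x. g + x) ` A)"
  by (intro compact_continuous_image assms continuous_intros)

lemma borel_left_translate:
  fixes g :: "'a::topological_group_add"
  assumes "A \<in> sets borel"
  shows "(\<lambda>x. g + x) ` A \<in> sets borel"
proof -
  have "(\<lambda>x. - g + x) \<in> borel_measurable borel"
    by (intro borel_measurable_continuous_onI continuous_intros)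
  from measurable_sets[OF this assms] show ?thesis
    unfolding left_translate_eq_vimage by simp
qed

text \<open>Continuity of addition at \<open>(0, 0)\<close> gives a neighborhood whose sums lie in
  \<open>O'\<close>; intersecting it with its negative makes it symmetric.\<close>

lemma exists_symmetric_open_sum_subset:
  fixes O' :: "'a::topological_group_add set"
  assumes "open O'" "0 \<in> O'"
  shows "\<exists>V. open V \<and> 0 \<in> V \<and> (\<forall>x\<in>V. - x \<in> V) \<and> (\<forall>x\<in>V. \<forall>y\<in>V. x + y \<in> O')"
proof -
  have "open ((\<lambda>p::'a\<times>'a. fst p + snd p) -` O')"
    by (intro open_vimage assms continuous_intros)
  moreover have "(0, 0) \<in> (\<lambda>p::'a\<times>'a. fst p + snd p) -` O'"
    using assms by simp
  ultimately obtain A B where AB: "open A" "open B" "(0, 0) \<in> A \<times> B"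
      "A \<times> B \<subseteq> (\<lambda>p::'a\<times>'a. fst p + snd p) -` O'"
    by (rule open_prod_elim)
  define V where "V = (A \<inter> B) \<inter> uminus -` (A \<inter> B)"
  have "open V"
    unfolding V_def by (intro open_Int open_vimage AB continuous_intros)
  moreover have "x + y \<in> O'" if "x \<in> V" "y \<in> V" for x y
    using that subsetD[OF AB(4), of "(x, y)"] by (auto simp: V_def)
  moreover have "0 \<in> V" "\<forall>x\<in>V. - x \<in> V"
    using AB(3) by (auto simp: V_def)
  ultimately show ?thesis by blast
qed

section \<open>Positivity, absence of atoms and divisibility of Haar measure\<close>

lemma haar_sets: "haar_measure M \<Longrightarrow> sets M = sets borel"
  by (simp add: haar_measure_def radon_measure_def)

lemma haar_fmeasurable_compact:
  fixes M :: "'a::{topological_group_add, t2_space} measure"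
  assumes "haar_measure M" "compact K"
  shows "K \<in> fmeasurable M"
proof (rule fmeasurableI)
  show "K \<in> sets M"
    using borel_closed[OF compact_imp_closed[OF assms(2)]] by (simp add: haar_sets[OF assms(1)])
  show "emeasure M K < \<infinity>"
    using assms unfolding haar_measure_def radon_measure_def by (elim conjE) simp
qed

lemma haar_left_translate:
  assumes "haar_measure M" "A \<in> sets borel"
  shows "emeasure M ((\<lambda>x. g + x) ` A) = emeasure M A" "measure M ((\<lambda>x. g + x) ` A) = measure M A"
  using assms by (auto simp: haar_measure_def measure_def)

lemma compact_subset_left_translates:
  fixes K :: "'a::topological_group_add set"
  assumes "compact K" "open V" "0 \<in> V"
  obtains D where "finite D" "D \<subseteq> K" "K \<subseteq> (\<Union>d\<in>D. (\<lambda>x. d + x) ` V)"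
proof -
  have "K \<subseteq> (\<Union>d\<in>K. (\<lambda>x. d + x) ` V)"
    using assms(3) by force
  from compactE_image[OF assms(1) open_left_translate[OF assms(2)] this]
  obtain D where "D \<subseteq> K" "finite D" "K \<subseteq> (\<Union>d\<in>D. (\<lambda>x. d + x) ` V)" .
  with that show ?thesis by simp
qed

text \<open>Finitely many translates of a null neighborhood would cover any compact set, so all
  compact sets would be null, and by inner regularity the whole group too.\<close>

lemma haar_open_pos:
  fixes M :: "'a::{topological_group_add, t2_space} measure"
  assumes M: "haar_measure M" and V: "open V" "0 \<in> V"
  shows "emeasure M V > 0"
proof (rule ccontr)
  assume "\<not> ?thesis"
  then have V0: "emeasure M V = 0" by simp
  have "emeasure M K = 0" if K: "compact K" for K
  proof -
    obtain D where D: "finite D" "K \<subseteq> (\<Union>d\<in>D. (\<lambda>x. d + x) ` V)"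
      using compact_subset_left_translates[OF K V] by metis
    have "(\<lambda>x. d + x) ` V \<in> null_sets M" for d
      using haar_left_translate(1)[OF M, of V d] V0 V open_left_translate[of V d]
      by (auto simp: null_sets_def haar_sets[OF M])
    then have "(\<Union>d\<in>D. (\<lambda>x. d + x) ` V) \<in> null_sets M"
      using D by (intro null_sets.finite_UN) auto
    then have "K \<in> null_sets M"
      using haar_fmeasurable_compact[OF M K] D(2) by (intro null_sets_subset[of _ M K]) auto
    then show ?thesis by auto
  qed
  moreover have "emeasure M UNIV = (SUP K \<in> {K. compact K \<and> K \<subseteq> UNIV}. emeasure M K)"
    using M unfolding haar_measure_def radon_measure_def by (meson open_UNIV)
  ultimately have "emeasure M UNIV = 0"
    by (auto intro!: SUP_eqI)
  then show False using M by (simp add: haar_measure_def)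
qed

text \<open>By invariance all points have the same mass. If it were positive, a compact neighborhood
  of finite measure would be a finite set, and in a Hausdorff group this makes points open.\<close>

lemma haar_singleton_null:
  fixes M :: "'a::{topological_group_add, t2_space} measure"
  assumes M: "haar_measure M" and lc: "locally_compact_type TYPE('a)"
    and nd: "\<not> discrete_type TYPE('a)"
  shows "emeasure M {0} = 0"
proof (rule ccontr)
  assume pos: "emeasure M {0} \<noteq> 0"
  obtain V K where VK: "open V" "compact K" "(0::'a) \<in> V" "V \<subseteq> K"
    using lc unfolding locally_compact_type_def by blast
  have e: "measure M {x} = measure M {0}" for x
    using haar_left_translate(2)[OF M, of "{0}" x] by simp
  have f: "{x} \<in> fmeasurable M" for x
    using haar_fmeasurable_compact[OF M] by simp
  have p: "measure M {0} > 0"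
    using pos f[of 0] emeasure_eq_measure2[OF f[of 0]] zero_less_measure_iff by fastforce
  have "finite V"
  proof (rule ccontr)
    assume "infinite V"
    obtain n :: nat where n: "measure M K < real n * measure M {0}"
      using ex_less_of_nat_mult[OF p] by blast
    obtain F where F: "F \<subseteq> V" "finite F" "card F = n"
      using infinite_arbitrarily_large[OF \<open>infinite V\<close>] by metis
    have "measure M F = (\<Sum>x\<in>F. measure M {x})"
      using F f by (intro measure_eq_sum_singleton) (auto simp: fmeasurableD2)
    also have "\<dots> = (\<Sum>x\<in>F. measure M {0})"
      by (intro sum.cong refl e)
    finally have "measure M F = real n * measure M {0}"
      using F(3) by simp
    moreover have "measure M F \<le> measure M K"
      using order_trans[OF F(1) VK(4)] haar_fmeasurable_compact[OF M finite_imp_compact[OF F(2)]]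
      by (intro measure_mono_fmeasurable haar_fmeasurable_compact[OF M VK(2)]) auto
    ultimately show False using n by simp
  qed
  have "open {x}" for x :: 'a
  proof -
    have "open (V - (V - {0}))"
      using \<open>finite V\<close> by (intro open_Diff finite_imp_closed VK(1)) simp
    moreover have "V - (V - {0}) = {0}" using VK(3) by blast
    ultimately have "open {0::'a}" by simp
    from open_left_translate[OF this, of x] show ?thesis by simp
  qed
  then show False using nd by (simp add: discrete_type_def)
qed

text \<open>Outer regularity at the null set \<open>{0}\<close> gives an open neighborhood of
  measure below \<open>\<delta>\<close>, and finitely many of its translates cover
  \<open>K\<close>.\<close>

lemma haar_compact_finely_divisible:
  fixes M :: "'a::{topological_group_add, t2_space} measure"
  assumes M: "haar_measure M" and "locally_compact_type TYPE('a)"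
    and "\<not> discrete_type TYPE('a)" and K: "compact K"
  shows "finely_divisible M K"
  unfolding finely_divisible_def
proof (intro allI impI)
  fix \<delta> :: real assume "\<delta> > 0"
  have "(INF V \<in> {V. open V \<and> {0} \<subseteq> V}. emeasure M V) = emeasure M {0}"
    using M unfolding haar_measure_def radon_measure_def by auto
  also have "\<dots> < ennreal \<delta>"
    using haar_singleton_null[OF assms(1-3)] \<open>\<delta> > 0\<close> by simp
  finally obtain V where V: "open V" "0 \<in> V" "emeasure M V < ennreal \<delta>"
    by (auto simp: INF_less_iff)
  have Vb: "V \<in> sets borel" using V by simp
  have Vf: "V \<in> fmeasurable M"
  proof (rule fmeasurableI)
    show "V \<in> sets M" using Vb by (simp add: haar_sets[OF M])
    show "emeasure M V < \<infinity>"
      using order.strict_trans[OF V(3) ennreal_less_top] by simp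
  qed
  have Vm: "measure M V < \<delta>"
    using V(3) \<open>\<delta> > 0\<close> emeasure_eq_measure2[OF Vf] by (simp add: ennreal_less_iff)
  obtain D where D: "finite D" "K \<subseteq> (\<Union>d\<in>D. (\<lambda>x. d + x) ` V)"
    using compact_subset_left_translates[OF K V(1,2)] by metis
  have "(\<lambda>x. d + x) ` V \<in> fmeasurable M" for d
    using borel_left_translate[OF Vb] haar_left_translate(1)[OF M Vb] fmeasurableD2[OF Vf]
    by (intro fmeasurableI) (auto simp: haar_sets[OF M] less_top)
  then show "\<exists>\<D>. finite \<D> \<and> \<D> \<subseteq> fmeasurable M \<and> K \<subseteq> \<Union>\<D> \<and> (\<forall>D\<in>\<D>. measure M D < \<delta>)"
    using D Vm haar_left_translate(2)[OF M Vb]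
    by (intro exI[of _ "(\<lambda>d. (\<lambda>x. d + x) ` V) ` D"]) auto
qed

section \<open>Separated trees in a generated subgroup\<close>

text \<open>Words in \<open>V\<close>, built by appending letters on the right; for symmetric
  \<open>V\<close> they form the generated subgroup. The induction walks along a word, which is how
  separated trees are grown.\<close>

inductive_set generated :: "'a::group_add set \<Rightarrow> 'a set" for V where
  zero: "0 \<in> generated V"
| add: "x \<in> generated V \<Longrightarrow> v \<in> V \<Longrightarrow> x + v \<in> generated V"

lemma generated_plus:
  assumes "x \<in> generated V" "y \<in> generated V"
  shows "x + y \<in> generated V"
  using assms(2,1) by induction (auto simp: add.assoc[symmetric] intro: generated.add)

lemma generated_base: "v \<in> V \<Longrightarrow> v \<in> generated V"
  using generated.add[OF generated.zero] by force

lemma generated_uminus: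
  assumes "\<forall>v\<in>V. - v \<in> V" "x \<in> generated V"
  shows "- x \<in> generated V"
  using assms(2)
proof induction
  case zero
  then show ?case by (simp add: generated.zero)
next
  case (add x v)
  then show ?case
    using generated_plus[OF generated_base add.IH, of "- v"] assms(1) by (simp only: minus_add)
qed

text \<open>Adjacency is invariant under left translation. It allows two steps because distinct
  vertices of a \<open>V\<close>-separated set are never a single \<open>V\<close>-step
  apart.\<close>

definition near2 :: "'a::group_add set \<Rightarrow> 'a \<Rightarrow> 'a \<Rightarrow> bool" where
  "near2 V f g \<longleftrightarrow> (\<exists>a\<in>V. \<exists>b\<in>V. g = f + a + b)"

definition separated_tree :: "'a::group_add set \<Rightarrow> 'a set \<Rightarrow> bool" where
  "separated_tree V F \<longleftrightarrow> tree_on (near2 V) F \<and> F \<subseteq> generated V \<and>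
     (\<forall>f\<in>F. \<forall>g\<in>F. f \<noteq> g \<longrightarrow> - f + g \<notin> V)"

text \<open>Follow a word for \<open>x\<close>. If \<open>f\<close> is within \<open>V\<close> of a
  prefix, then one letter further is within two steps of \<open>f\<close>: either some vertex is
  already \<open>V\<close>-close to the new point, or the point itself becomes a leaf.\<close>

lemma separated_tree_extend:
  assumes sym: "\<forall>v\<in>V. - v \<in> V" and "0 \<in> V"
    and "x \<in> generated V" and "separated_tree V F" "0 \<in> F"
  shows "\<exists>F'. separated_tree V F' \<and> F \<subseteq> F' \<and> (\<exists>f\<in>F'. - f + x \<in> V)"
  using assms(3)
proof induction
  case zero
  then show ?case using assms by (intro exI[of _ F]) force
next
  case (add x v)
  then obtain F' f where F': "separated_tree V F'" "F \<subseteq> F'" "f \<in> F'" "- f + x \<in> V"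
    by (elim exE conjE bexE)
  show ?case
  proof (cases "\<exists>f\<in>F'. - f + (x + v) \<in> V")
    case True
    then show ?thesis using F' by blast
  next
    case False
    let ?y = "x + v"
    have "?y \<notin> F'" using False \<open>0 \<in> V\<close> by force
    moreover have "near2 V f ?y"
      unfolding near2_def using F'(4) add.hyps(2)
      by (intro bexI[of _ "- f + x"] bexI[of _ v]) (simp_all add: add.assoc[symmetric])
    ultimately have "tree_on (near2 V) (insert ?y F')"
      using F' by (intro tree_on.leaf[of _ F' f]) (auto simp: separated_tree_def)
    moreover have "?y \<in> generated V" using add.hyps by (rule generated.add)
    \<comment> \<open>Separation is required in both orders; this one is the negative of
      \<open>- g + ?y\<close>, so symmetry of \<open>V\<close> transfers it.\<close>
    moreover have "- ?y + g \<notin> V" if "g \<in> F'" for g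
      using bspec[OF sym, of "- ?y + g"] False that by (auto simp: minus_add)
    ultimately have "separated_tree V (insert ?y F')"
      using F'(1) False by (auto simp: separated_tree_def)
    then show ?thesis
      using F'(2) \<open>0 \<in> V\<close> by (intro exI[of _ "insert ?y F'"]) auto
  qed
qed

text \<open>Starting from \<open>{0}\<close>, the tree is extended for one point of \<open>X\<close>
  after another. It only grows, so points already approximated stay approximated.\<close>

lemma exists_separated_tree:
  assumes sym: "\<forall>v\<in>V. - v \<in> V" and "0 \<in> V" and "finite X" "X \<subseteq> generated V"
  shows "\<exists>F. separated_tree V F \<and> 0 \<in> F \<and> (\<forall>x\<in>X. \<exists>f\<in>F. - f + x \<in> V)"
  using assms(3,4)
proof (induction X rule: finite_induct)
  case empty
  have "separated_tree V {0}"
    by (auto simp: separated_tree_def intro: tree_on.root generated.zero)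
  then show ?case by blast
next
  case (insert x X)
  then obtain F where F: "separated_tree V F" "0 \<in> F" "\<forall>x\<in>X. \<exists>f\<in>F. - f + x \<in> V"
    by auto
  obtain F' where "separated_tree V F'" "F \<subseteq> F'" "\<exists>f\<in>F'. - f + x \<in> V"
    using separated_tree_extend[OF sym \<open>0 \<in> V\<close> _ F(1,2), of x] insert.prems by auto
  then show ?case using F by (intro exI[of _ F']) blast
qed

section \<open>Equipartition of a compact subset of the generated subgroup\<close>

text \<open>Of the five summands in the bound by \<open>U\<close>, two pay for a tree edge and three
  for a point of the closure of \<open>V + V\<close>. The bound by \<open>L\<close> makes this
  closure compact.\<close>

lemma equipartition_in_generated:
  fixes M :: "'a::{topological_group_add, t2_space} measure"
  assumes M: "haar_measure M" and lc: "locally_compact_type TYPE('a)"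
    and nd: "\<not> discrete_type TYPE('a)"
    and V: "open V" "0 \<in> V" and sym: "\<forall>v\<in>V. - v \<in> V"
    and L: "compact L" "\<And>a b c. a \<in> V \<Longrightarrow> b \<in> V \<Longrightarrow> c \<in> V \<Longrightarrow> a + b + c \<in> L"
    and U: "\<And>a b c d e. a \<in> V \<Longrightarrow> b \<in> V \<Longrightarrow> c \<in> V \<Longrightarrow> d \<in> V \<Longrightarrow> e \<in> V \<Longrightarrow> a + b + c + d + e \<in> U"
    and X: "finite X" "X \<subseteq> generated V"
  shows "\<exists>C P. compact C \<and> C \<subseteq> generated V \<and> (\<forall>x\<in>X. \<forall>v\<in>V. x + v \<in> C) \<and>
           measurable_partition M P C \<and> U_fine U P \<and> equisize M P"
proof -
  define Q where "Q = {a + b |a b. a \<in> V \<and> b \<in> V}"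
  define K where "K = closure Q"
  have QK: "a + b \<in> K" if "a \<in> V" "b \<in> V" for a b
    unfolding K_def Q_def using that by (intro subsetD[OF closure_subset]) blast
  have VK: "V \<subseteq> K" using QK[OF _ V(2)] by auto
  \<comment> \<open>The neighborhood \<open>x + V\<close> of a point of the closure meets
    \<open>V + V\<close>, so one more summand from the symmetric set \<open>V\<close> absorbs the
    closure.\<close>
  have K3: "\<exists>a\<in>V. \<exists>b\<in>V. \<exists>c\<in>V. x = a + b + c" if x: "x \<in> K" for x
  proof -
    have "x \<in> (\<lambda>u. x + u) ` V"
      using imageI[OF V(2), of "\<lambda>u. x + u"] by simp
    then have "Q \<inter> (\<lambda>u. x + u) ` V \<noteq> {}"
      using x open_left_translate[OF V(1)] open_Int_closure_eq_empty[of "(\<lambda>u. x + u) ` V" Q]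
      unfolding K_def by blast
    then obtain y c where y: "y \<in> Q" "c \<in> V" "y = x + c"
      by blast
    then obtain a b where ab: "a \<in> V" "b \<in> V" "y = a + b"
      unfolding Q_def by blast
    have "x = y + - c" unfolding y(3) by (simp add: add.assoc)
    then have "x = a + b + - c" unfolding ab(3) .
    with ab(1,2) bspec[OF sym y(2)] show ?thesis by (intro bexI)
  qed
  have KL: "K \<subseteq> L"
  proof
    fix x assume "x \<in> K"
    then show "x \<in> L" using K3[of x] L(2) by auto
  qed
  have "compact (L \<inter> K)"
    unfolding K_def by (intro compact_Int_closed L closed_closure)
  then have K: "compact K" using KL by (simp add: Int_absorb1)
  \<comment> \<open>If \<open>f + W\<close> and \<open>g + W\<close> meet, then
    \<open>- f + g\<close> lies in \<open>W + W\<close>, hence in \<open>V\<close>. So separation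
    makes these translates disjoint over \<open>F\<close>.\<close>
  obtain W where W: "open W" "0 \<in> W" "\<forall>x\<in>W. - x \<in> W" "\<forall>x\<in>W. \<forall>y\<in>W. x + y \<in> V"
    using exists_symmetric_open_sum_subset[OF V] by (elim exE conjE)
  have WK: "W \<subseteq> K"
  proof
    fix w assume "w \<in> W"
    then have "w + 0 \<in> V" using W(2,4) by blast
    then show "w \<in> K" using VK by auto
  qed
  obtain F where F: "separated_tree V F" "0 \<in> F" "\<forall>x\<in>X. \<exists>f\<in>F. - f + x \<in> V"
    using exists_separated_tree[OF sym V(2) X] by (elim exE conjE)
  have tree: "tree_on (near2 V) F" and Fgen: "F \<subseteq> generated V"
    and sep: "\<forall>f\<in>F. \<forall>g\<in>F. f \<noteq> g \<longrightarrow> - f + g \<notin> V"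
    using F(1) by (auto simp: separated_tree_def)
  have fin: "finite F" using tree by (rule tree_on_finite)
  \<comment> \<open>Since \<open>K\<close> contains \<open>V + V\<close>, the translate
    \<open>f + K\<close> contains \<open>x + V\<close> as soon as \<open>x\<close> lies in
    \<open>f + V\<close>.\<close>
  define C where "C = (\<Union>f\<in>F. (\<lambda>u. f + u) ` K)"
  have C: "compact C"
    unfolding C_def by (intro compact_UN fin compact_left_translate K)
  have Cgen: "C \<subseteq> generated V"
  proof
    fix x assume "x \<in> C"
    then obtain f k where "f \<in> F" "k \<in> K" "x = f + k" unfolding C_def by auto
    moreover from K3[OF \<open>k \<in> K\<close>] have "k \<in> generated V"
      by (auto intro: generated_plus generated_base)
    ultimately show "x \<in> generated V" using Fgen by (auto intro: generated_plus)
  qed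
  have XC: "x + v \<in> C" if "x \<in> X" "v \<in> V" for x v
  proof -
    obtain f where f: "f \<in> F" "- f + x \<in> V" using F(3) \<open>x \<in> X\<close> by blast
    have "x + v = f + ((- f + x) + v)" by (simp add: add.assoc[symmetric])
    then show ?thesis unfolding C_def using f QK[OF f(2) \<open>v \<in> V\<close>] by blast
  qed
  have Kb: "K \<in> sets borel" using borel_closed[OF compact_imp_closed[OF K]] .
  have Wb: "W \<in> sets borel" using borel_open[OF W(1)] .
  have Wdisj: "disjoint_family_on (\<lambda>f. (\<lambda>u. f + u) ` W) F"
  proof (unfold disjoint_family_on_def, intro ballI impI, rule ccontr)
    fix f g assume fg: "f \<in> F" "g \<in> F" "f \<noteq> g" "(\<lambda>u. f + u) ` W \<inter> (\<lambda>u. g + u) ` W \<noteq> {}"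
    then obtain w w' where w: "w \<in> W" "w' \<in> W" "f + w = g + w'" by auto
    have "g = f + w - w'" unfolding w(3) by simp
    then have "- f + g = w + - w'" by (simp add: add.assoc[symmetric] diff_conv_add_uminus del: add_uminus_conv_diff)
    then have "- f + g \<in> V" using W w by metis
    then show False using sep fg by blast
  qed
  have "\<exists>A. disjoint_family_on A F \<and> \<Union>(A ` F) = \<Union>((\<lambda>f. (\<lambda>u. f + u) ` K) ` F) \<and>
      (\<forall>f\<in>F. (\<lambda>u. f + u) ` W \<subseteq> A f \<and> A f \<subseteq> (\<lambda>u. f + u) ` K \<and> A f \<in> sets M)"
    using WK borel_left_translate[OF Wb] borel_left_translate[OF Kb]
    by (intro disjointify_keeping_cores[OF fin Wdisj]) (auto simp: haar_sets[OF M])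
  then obtain A where A: "disjoint_family_on A F" "\<Union>(A ` F) = C"
    "\<forall>f\<in>F. (\<lambda>u. f + u) ` W \<subseteq> A f \<and> A f \<subseteq> (\<lambda>u. f + u) ` K \<and> A f \<in> sets M"
    unfolding C_def by (elim exE conjE)
  have Cf: "C \<in> fmeasurable M" using haar_fmeasurable_compact[OF M C] .
  have Af: "A f \<in> fmeasurable M" if "f \<in> F" for f
    using fmeasurableI2[OF Cf, of "A f"] A(2) bspec[OF A(3) that] that by blast
  define w where "w = measure M W"
  have Wf: "W \<in> fmeasurable M"
    using fmeasurableI2[OF haar_fmeasurable_compact[OF M K] WK] Wb by (simp add: haar_sets[OF M])
  have w: "w > 0"
    using haar_open_pos[OF M W(1,2)] emeasure_eq_measure2[OF Wf] by (simp add: w_def)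
  have wA: "w \<le> measure M (A f)" if "f \<in> F" for f
  proof -
    have "w = measure M ((\<lambda>u. f + u) ` W)"
      unfolding w_def using haar_left_translate(2)[OF M Wb] by simp
    also have "\<dots> \<le> measure M (A f)"
      using bspec[OF A(3) that] borel_left_translate[OF Wb]
      by (intro measure_mono_fmeasurable Af[OF that]) (auto simp: haar_sets[OF M])
    finally show ?thesis .
  qed
  define m where "m = measure M C"
  have "measure M (A 0) \<le> m"
    unfolding m_def using F(2) A(2) fmeasurableD[OF Af[OF F(2)]]
    by (intro measure_mono_fmeasurable Cf) auto
  then have m: "m > 0" using w wA[OF F(2)] by linarith
  obtain N :: nat where N: "m < real N * w" using ex_less_of_nat_mult[OF w] by blast
  have N0: "N > 0" using N m by (cases N) auto
  \<comment> \<open>An exact fraction of the total measure, with \<open>N\<close> so large that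
    \<open>\<epsilon> \<le> w\<close> and every core can supply a remainder.\<close>
  define \<epsilon> where "\<epsilon> = m / real N"
  have eps: "\<epsilon> > 0" using m N0 by (simp add: \<epsilon>_def)
  have epsw: "\<epsilon> \<le> w" using N N0 by (simp add: \<epsilon>_def field_simps)
  have relS: "A g \<subseteq> (\<lambda>u. f + u) ` U" if "g \<in> F" and near: "near2 V f g" for f g
  proof
    fix x assume "x \<in> A g"
    then obtain k where k: "k \<in> K" "x = g + k" using bspec[OF A(3) \<open>g \<in> F\<close>] by blast
    obtain a b c where abc: "a \<in> V" "b \<in> V" "c \<in> V" "k = a + b + c" using K3[OF k(1)] by blast
    obtain d e where de: "d \<in> V" "e \<in> V" "g = f + d + e" using near unfolding near2_def by blast
    have "x = f + (d + e + a + b + c)" unfolding k abc de by (simp add: add.assoc)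
    then show "x \<in> (\<lambda>u. f + u) ` U" using U[OF de(1,2) abc(1-3)] by blast
  qed
  \<comment> \<open>Each \<open>f\<close> is adjacent to itself, with both steps equal to
    \<open>0\<close>.\<close>
  have selfS: "A f \<subseteq> (\<lambda>u. f + u) ` U" if "f \<in> F" for f
    using relS[OF that, of f] V(2) unfolding near2_def by force
  have total: "measure M (\<Union>(A ` F)) = real N * \<epsilon>"
    unfolding A(2) using N0 by (simp add: \<epsilon>_def m_def)
  have CfU: "\<Union>(A ` F) \<subseteq> C" unfolding A(2) ..
  have "\<exists>P. finite P \<and> disjoint P \<and> P \<subseteq> fmeasurable M \<and> \<Union>P = \<Union>(A ` F) \<and>
      (\<forall>Y\<in>P. measure M Y = \<epsilon> \<and> (\<exists>f\<in>F. Y \<subseteq> (\<lambda>u. f + u) ` U))"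
  \<comment> \<open>Before any mass moves, the load of each vertex is its core, so \<open>A\<close>
    is used for both families.\<close>
  proof (rule tree_equipartition[where A = A, OF tree eps _ _ _ _ _ _
          haar_compact_finely_divisible[OF M lc nd C] CfU A(1) total])
    fix f assume f: "f \<in> F"
    show "A f \<in> sets M" using bspec[OF A(3) f] by simp
    show "\<epsilon> \<le> measure M (A f)" using order_trans[OF epsw wA[OF f]] .
  qed (simp_all add: relS selfS Af)
  then obtain P where P: "finite P" "disjoint P" "P \<subseteq> fmeasurable M" "\<Union>P = C"
      "\<forall>Y\<in>P. measure M Y = \<epsilon> \<and> (\<exists>f\<in>F. Y \<subseteq> (\<lambda>u. f + u) ` U)"
    unfolding A(2) by (elim exE conjE)
  have "{} \<notin> P" using bspec[OF P(5), of "{}"] eps by auto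
  then have "measurable_partition M P C"
    using P(1-4) by (auto simp: measurable_partition_def disjoint_def)
  moreover have "U_fine U P" using P(5) unfolding U_fine_def by blast
  moreover have "emeasure M Y = ennreal \<epsilon>" if "Y \<in> P" for Y
    using emeasure_eq_measure2[OF subsetD[OF P(3) that]] bspec[OF P(5) that] by simp
  then have "equisize M P" unfolding equisize_def by simp
  ultimately show ?thesis using C Cgen XC by (intro exI[of _ C] exI[of _ P] conjI) auto
qed

section \<open>Copying the partition into the cosets meeting the given compact set\<close>

theorem theorem5:
  fixes \<nu> :: "'a::{topological_group_add, t2_space} measure"
  assumes "locally_compact_type TYPE('a)"
    and "\<not> discrete_type TYPE('a)"
    and "unimodular_haar \<nu>"
    and "neighborhood_of U 0"
    and "compact B"
  shows "\<exists>C. compact C \<and> B \<subseteq> C \<and>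
           (\<exists>P. measurable_partition \<nu> P C \<and> U_fine U P \<and> equisize \<nu> P)"
proof -
  have M: "haar_measure \<nu>" using assms(3) by (simp add: unimodular_haar_def)
  obtain U0 where U0: "open U0" "0 \<in> U0" "U0 \<subseteq> U"
    using assms(4) unfolding neighborhood_of_def by blast
  obtain L0 L where L: "open L0" "compact L" "(0::'a) \<in> L0" "L0 \<subseteq> L"
    using assms(1) unfolding locally_compact_type_def by blast
  \<comment> \<open>Three successive halvings give room for eight summands from \<open>V\<close>.
    Five are needed, and the rest is padded with \<open>0\<close>.\<close>
  have "open (U0 \<inter> L0)" "0 \<in> U0 \<inter> L0" using U0 L by auto
  from exists_symmetric_open_sum_subset[OF this]
  obtain V1 where V1: "open V1" "0 \<in> V1" "\<forall>x\<in>V1. \<forall>y\<in>V1. x + y \<in> U0 \<inter> L0"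
    by (elim exE conjE)
  from exists_symmetric_open_sum_subset[OF V1(1,2)]
  obtain V2 where V2: "open V2" "0 \<in> V2" "\<forall>x\<in>V2. \<forall>y\<in>V2. x + y \<in> V1"
    by (elim exE conjE)
  from exists_symmetric_open_sum_subset[OF V2(1,2)]
  obtain V where V: "open V" "0 \<in> V" "\<forall>x\<in>V. - x \<in> V" "\<forall>x\<in>V. \<forall>y\<in>V. x + y \<in> V2"
    by (elim exE conjE)
  have V5: "a + b + c + d + e \<in> U0 \<inter> L0"
    if "a \<in> V" "b \<in> V" "c \<in> V" "d \<in> V" "e \<in> V" for a b c d e
  proof -
    have "a + b + (c + d) \<in> V1" using that V(4) V2(3) by blast
    moreover have "e + 0 + 0 \<in> V1" using that V(2,4) V2(2,3) by blast
    ultimately have "a + b + (c + d) + (e + 0 + 0) \<in> U0 \<inter> L0" using V1(3) by blast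
    then show ?thesis by (simp add: add.assoc)
  qed
  have V3: "a + b + c \<in> L" if "a \<in> V" "b \<in> V" "c \<in> V" for a b c
    using V5[OF that V(2) V(2)] L(4) by auto
  define H where "H = generated V"
  have Hplus: "x + y \<in> H" if "x \<in> H" "y \<in> H" for x y
    using that unfolding H_def by (rule generated_plus)
  have Hminus: "- x \<in> H" if "x \<in> H" for x
    using generated_uminus[OF V(3)] that unfolding H_def by blast
  have H0: "0 \<in> H" unfolding H_def by (rule generated.zero)
  \<comment> \<open>A chosen point of the left coset \<open>x + H\<close>. Points of one coset
    define equivalent predicates, so \<open>SOME\<close> returns the same representative for all of
    them.\<close>
  define rep where "rep x = (SOME y. - x + y \<in> H)" for x
  have rep: "- x + rep x \<in> H" for x
    unfolding rep_def by (rule someI[of _ x]) (simp add: H0)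
  have rep_eq: "rep x = rep y" if "- rep x + rep y \<in> H" for x y
  proof -
    have xy: "- x + y \<in> H"
      using Hplus[OF Hplus[OF rep[of x] that] Hminus[OF rep[of y]]]
      by (simp add: minus_add add.assoc)
    have "- x + z \<in> H \<longleftrightarrow> - y + z \<in> H" for z
    proof
      assume "- x + z \<in> H"
      from Hplus[OF Hminus[OF xy] this] show "- y + z \<in> H" by (simp add: minus_add add.assoc)
    next
      assume "- y + z \<in> H"
      from Hplus[OF xy this] show "- x + z \<in> H" by (simp add: add.assoc)
    qed
    then show ?thesis unfolding rep_def by simp
  qed
  obtain D where D: "finite D" "B \<subseteq> (\<Union>d\<in>D. (\<lambda>x. d + x) ` V)"
    using compact_subset_left_translates[OF assms(5) V(1,2)] by metis
  \<comment> \<open>The centers of the cover of \<open>B\<close>, moved into \<open>H\<close> by the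
    representatives of their cosets.\<close>
  define X where "X = (\<lambda>b. - rep b + b) ` D"
  have "X \<subseteq> generated V"
  proof
    fix y assume "y \<in> X"
    then obtain b where "y = - rep b + b" unfolding X_def by blast
    then show "y \<in> generated V"
      using Hminus[OF rep[of b]] unfolding H_def[symmetric] by (simp add: minus_add)
  qed
  then have "\<exists>C P. compact C \<and> C \<subseteq> generated V \<and> (\<forall>x\<in>X. \<forall>v\<in>V. x + v \<in> C) \<and>
           measurable_partition \<nu> P C \<and> U_fine U P \<and> equisize \<nu> P"
    using V5 U0(3) D(1)
    by (intro equipartition_in_generated[OF M assms(1,2) V(1-3) L(2) V3]) (auto simp: X_def)
  then obtain C P where C: "compact C" "C \<subseteq> H" "\<forall>x\<in>X. \<forall>v\<in>V. x + v \<in> C"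
    and P: "measurable_partition \<nu> P C" "U_fine U P" "equisize \<nu> P"
    unfolding H_def by (elim exE conjE)
  have Pf: "finite P" "P \<subseteq> sets \<nu>" "{} \<notin> P" "\<Union>P = C" "\<forall>A\<in>P. \<forall>B\<in>P. A \<noteq> B \<longrightarrow> A \<inter> B = {}"
    using P(1) unfolding measurable_partition_def by simp_all
  \<comment> \<open>Indexing by \<open>rep\<close> followed by the image of \<open>D\<close> takes
    each coset once. As \<open>C\<close> lies in \<open>H\<close>, copies at different
    representatives lie in different cosets.\<close>
  define C' where "C' = (\<Union>x\<in>rep ` D. (\<lambda>u. x + u) ` C)"
  define P' where "P' = (\<lambda>(x, A). (\<lambda>u. x + u) ` A) ` (rep ` D \<times> P)"
  have P'E: "\<exists>x\<in>rep ` D. \<exists>A\<in>P. Y = (\<lambda>u. x + u) ` A" if "Y \<in> P'" for Y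
    using that unfolding P'_def by auto
  have "compact C'"
    unfolding C'_def using D(1) by (intro compact_UN compact_left_translate C) auto
  moreover have "B \<subseteq> C'"
  proof
    fix y assume "y \<in> B"
    then obtain d v where d: "d \<in> D" "v \<in> V" "y = d + v" using D(2) by blast
    have "y = rep d + ((- rep d + d) + v)" unfolding d by (simp add: add.assoc[symmetric])
    moreover have "(- rep d + d) + v \<in> C" using C(3) d unfolding X_def by blast
    ultimately show "y \<in> C'" using d(1) unfolding C'_def by blast
  qed
  moreover have "measurable_partition \<nu> P' C'"
    unfolding measurable_partition_def
  proof (intro conjI ballI impI)
    show "finite P'" unfolding P'_def using D(1) Pf(1) by auto
    show "P' \<subseteq> sets \<nu>"
      unfolding P'_def using Pf(2) borel_left_translate by (auto simp: haar_sets[OF M])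
    show "{} \<notin> P'" unfolding P'_def using Pf(3) by auto
    show "\<Union>P' = C'" unfolding P'_def C'_def Pf(4)[symmetric] by auto
    fix Y Z assume "Y \<in> P'" "Z \<in> P'" "Y \<noteq> Z"
    obtain x A where Y: "x \<in> rep ` D" "A \<in> P" "Y = (\<lambda>u. x + u) ` A" using P'E[OF \<open>Y \<in> P'\<close>] by blast
    obtain z B where Z: "z \<in> rep ` D" "B \<in> P" "Z = (\<lambda>u. z + u) ` B" using P'E[OF \<open>Z \<in> P'\<close>] by blast
    show "Y \<inter> Z = {}"
    proof (rule ccontr)
      assume "Y \<inter> Z \<noteq> {}"
      \<comment> \<open>A common point puts \<open>x\<close> and \<open>z\<close> into the same
        coset, so these representatives agree. Cancelling them gives a common point of
        \<open>A\<close> and \<open>B\<close>.\<close>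
      then obtain a b where ab: "a \<in> A" "b \<in> B" "x + a = z + b" unfolding Y Z by auto
      have "a \<in> H" "b \<in> H" using ab Y(2) Z(2) Pf(4) C(2) by blast+
      have "x = z + b - a" unfolding ab(3)[symmetric] by simp
      then have "- z + x = b + - a" by (simp add: add.assoc[symmetric] diff_conv_add_uminus del: add_uminus_conv_diff)
      then have "- z + x \<in> H" using Hplus[OF \<open>b \<in> H\<close> Hminus[OF \<open>a \<in> H\<close>]] by simp
      then have "z = x" using Y(1) Z(1) rep_eq by blast
      then have "A \<inter> B \<noteq> {}" using ab by auto
      then have "A = B" using Pf(5) Y(2) Z(2) by blast
      then show False using \<open>Y \<noteq> Z\<close> \<open>z = x\<close> Y(3) Z(3) by simp
    qed
  qed
  moreover have "U_fine U P'"
    unfolding U_fine_def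
  proof
    fix Y assume "Y \<in> P'"
    obtain x A where Y: "A \<in> P" "Y = (\<lambda>u. x + u) ` A" using P'E[OF \<open>Y \<in> P'\<close>] by blast
    obtain g where "A \<subseteq> (\<lambda>u. g + u) ` U" using P(2) Y(1) unfolding U_fine_def by blast
    then have "Y \<subseteq> (\<lambda>u. (x + g) + u) ` U" unfolding Y(2) by (auto simp: add.assoc)
    then show "\<exists>g. Y \<subseteq> (\<lambda>u. g + u) ` U" by blast
  qed
  moreover have "equisize \<nu> P'"
    unfolding equisize_def
  proof (intro ballI)
    fix Y Z assume "Y \<in> P'" "Z \<in> P'"
    obtain x A where Y: "A \<in> P" "Y = (\<lambda>u. x + u) ` A" using P'E[OF \<open>Y \<in> P'\<close>] by blast
    obtain z B where Z: "B \<in> P" "Z = (\<lambda>u. z + u) ` B" using P'E[OF \<open>Z \<in> P'\<close>] by blast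
    have "A \<in> sets borel" "B \<in> sets borel"
      using Pf(2) Y(1) Z(1) unfolding haar_sets[OF M] by blast+
    moreover have "emeasure \<nu> A = emeasure \<nu> B"
      using P(3) Y(1) Z(1) unfolding equisize_def by blast
    ultimately show "emeasure \<nu> Y = emeasure \<nu> Z"
      unfolding Y Z by (simp add: haar_left_translate(1)[OF M])
  qed
  ultimately show ?thesis by blast
qed

end
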